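(* There is a polynomial $\mathbf{ResSV}$ proof of $(\Box,1)$ from $\mathit{PHP}$: for every $m\ge1$ there is a proof $\mathit{PHP}_m\vdash_{\mathbf{ResSV}}\{(\Box,1)\}$ whose length is bounded by a polynomial in $m$.
   Context: A literal is a Boolean variable $x$ or its negation $\overline x$; a clause is a disjunction of literals ($\Box$ is the empty clause). Weights are elements of $\mathbb{R}_{>0}\cup\{\infty\}$ with $\infty+w=\infty-w=\infty$; during $\mathbf{ResSV}$ proofs clauses may also carry finite negative weights. A MaxSAT formula is a finite collection of weighted clauses $(C,w)$, where $(C,u),(C,v)$ may be merged into $(C,u+v)$ and conversely, and clauses of weight $0$ disappear. $\mathcal G\subseteq\mathcal F$ means every $(C,w)\in\mathcal G$ has some $(C,w')\in\mathcal F$ with $w\le w'$. A MaxSAT inference rule replaces its antecedents in the current formula by its consequents. A proof is a sequence $\mathcal F_0;\dots;\mathcal F_e$ (length $e$), each obtained from the previous by one rule application; $\mathcal F\vdash_{\mathbf{ResSV}}\mathcal G$ means there is such a proof with $\mathcal F_0=\mathcal F$, $\mathcal G\subseteq\mathcal F_e$ and all clauses of $\mathcal F_e$ having positive weight. $\mathbf{ResSV}$ rules: Resolution: from $(x\lor A,v),(\overline x\lor B,w)$ with $v,w$ positive ($A,B$ possibly empty), with $m=\min\{v,w\}$, derive $(A\lor B,m),(x\lor A,v-m),(\overline x\lor B,w-m),(x\lor A\lor\overline B,m),(\overline x\lor B\lor\overline A,m)$, where for $D=l_1\lor\dots\lor l_p$ the expression $(E\lor\overline D,u)$ stands for $(E\lor\overline{l_1},u),(E\lor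 l_1\lor\overline{l_2},u),\dots,(E\lor l_1\lor\dots\lor l_{p-1}\lor\overline{l_p},u)$ (nothing if $D$ is empty), and tautologies are discarded. Split: from $(A,w)$ with $w$ positive derive $(A\lor x,w),(A\lor\overline x,w)$. Virtual: with no antecedents, introduce $(A,w),(A,-w)$ for any clause $A$ and finite $w$. Pigeon hole problem: for $m\ge1$ take variables $x_{ij}$, $1\le i\le m+1$, $1\le j\le m$; let $\mathcal K_m$ consist of the clauses $x_{i1}\lor\dots\lor x_{im}$ for each $i$ and $\overline x_{ij}\lor\overline x_{i'j}$ for each $j$ and $1\le i<i'\le m+1$. $\mathit{PHP}_m=\{(C,\infty)\mid C\in\mathcal K_m\}$. *)

theory Defs
  imports
    "HOL-Library.Multiset"
    "HOL-Library.Extended_Real"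
    "HOL-Computational_Algebra.Polynomial"
begin

datatype 'a lit = Pos 'a | Neg 'a

fun compl :: "'a lit \<Rightarrow> 'a lit" where
  "compl (Pos x) = Neg x"
| "compl (Neg x) = Pos x"

type_synonym 'a clause = "'a lit set"

definition tautology :: "'a clause \<Rightarrow> bool" where
  "tautology C \<longleftrightarrow> (\<exists>x. Pos x \<in> C \<and> Neg x \<in> C)"

text \<open>
  Weights are extended reals other than \<open>-\<infinity>\<close>. On these, \<open>ereal\<close> arithmetic gives
  \<open>\<infinity> + w = \<infinity> - w = \<infinity>\<close>, including \<open>\<infinity> - \<infinity> = \<infinity>\<close>.
\<close>

type_synonym 'a formula = "('a clause \<times> ereal) multiset"

definition formula_sub :: "'a formula \<Rightarrow> 'a formula \<Rightarrow> bool" where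
  "formula_sub G F \<longleftrightarrow> (\<forall>(C, w) \<in># G. \<exists>w'. (C, w') \<in># F \<and> w \<le> w')"

text \<open>
  The bookkeeping on collections of weighted clauses, which is not counted as an inference.
  Clauses of weight \<open>0\<close> may only disappear, so a pair \<open>(C, w), (C, -w)\<close>
  of opposite weights cannot be created out of nothing by separating the weight \<open>0\<close>;
  this is what the virtual rule is for.
\<close>

inductive regroup :: "'a formula \<Rightarrow> 'a formula \<Rightarrow> bool" where
  merge: "regroup (F + {#(C, u), (C, v)#}) (F + {#(C, u + v)#})"
| separate: "\<lbrakk>u \<noteq> -\<infinity>; v \<noteq> -\<infinity>; u + v \<noteq> 0\<rbrakk>
    \<Longrightarrow> regroup (F + {#(C, u + v)#}) (F + {#(C, u), (C, v)#})"
| vanish: "regroup (F + {#(C, 0)#}) F"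

text \<open>
  \<open>or_neg E [l\<^sub>1, \<dots>, l\<^sub>p] u\<close> is \<open>(E \<or> \<not>(l\<^sub>1 \<or> \<dots> \<or> l\<^sub>p), u)\<close>, that is, the clauses
  \<open>E \<or> l\<^sub>1 \<or> \<dots> \<or> l\<^sub>k\<^sub>-\<^sub>1 \<or> \<not>l\<^sub>k\<close> for \<open>k = 1, \<dots>, p\<close>, each with weight \<open>u\<close>.
\<close>

fun or_neg :: "'a clause \<Rightarrow> 'a lit list \<Rightarrow> ereal \<Rightarrow> 'a formula" where
  "or_neg E [] u = {#}"
| "or_neg E (l # ls) u = add_mset (insert (compl l) E, u) (or_neg (insert l E) ls u)"

definition discard_tautologies :: "'a formula \<Rightarrow> 'a formula" where
  "discard_tautologies F = {#(C, w) \<in># F. \<not> tautology C#}"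

text \<open>
  In the resolution rule the lists \<open>A\<close> and \<open>B\<close> enumerate the side clauses in an arbitrary
  order; the order only affects the compensation clauses.
\<close>

inductive ressv_rule :: "'a formula \<Rightarrow> 'a formula \<Rightarrow> bool" where
  resolution: "\<lbrakk>0 < v; 0 < w; m = min v w;
      distinct A; distinct B; Pos x \<notin> set A; Neg x \<notin> set B\<rbrakk>
    \<Longrightarrow> ressv_rule
      (F + {#(insert (Pos x) (set A), v), (insert (Neg x) (set B), w)#})
      (F + discard_tautologies (
         {#(set A \<union> set B, m),
           (insert (Pos x) (set A), v - m),
           (insert (Neg x) (set B), w - m)#}
         + or_neg (insert (Pos x) (set A)) B m
         + or_neg (insert (Neg x) (set B)) A m))"
| split: "0 < w
    \<Longrightarrow> ressv_rule (F + {#(A, w)#}) (F + {#(insert (Pos x) A, w), (insert (Neg x) A, w)#})"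
| virtual: "finite A
    \<Longrightarrow> ressv_rule F (F + {#(A, ereal r), (A, ereal (- r))#})"

definition ressv_step :: "'a formula \<Rightarrow> 'a formula \<Rightarrow> bool" where
  "ressv_step F G \<longleftrightarrow> (\<exists>F' G'. regroup\<^sup>*\<^sup>* F F' \<and> ressv_rule F' G' \<and> regroup\<^sup>*\<^sup>* G' G)"

definition ressv_proof :: "'a formula \<Rightarrow> 'a formula \<Rightarrow> 'a formula list \<Rightarrow> bool" where
  "ressv_proof F G Fs \<longleftrightarrow>
     Fs \<noteq> [] \<and> hd Fs = F \<and> successively ressv_step Fs \<and>
     formula_sub G (last Fs) \<and> (\<forall>(C, w) \<in># last Fs. 0 < w)"

definition proof_length :: "'a formula list \<Rightarrow> nat" where
  "proof_length Fs = length Fs - 1"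

definition php_clauses :: "nat \<Rightarrow> (nat \<times> nat) clause set" where
  "php_clauses m =
     {{Pos (i, j) | j. 1 \<le> j \<and> j \<le> m} | i. 1 \<le> i \<and> i \<le> m + 1}
     \<union> {{Neg (i, j), Neg (i', j)} | i i' j. 1 \<le> j \<and> j \<le> m \<and> 1 \<le> i \<and> i < i' \<and> i' \<le> m + 1}"

lemma finite_php_clauses: "finite (php_clauses m)"
proof -
  have "php_clauses m \<subseteq>
      (\<lambda>i. {Pos (i, j) | j. 1 \<le> j \<and> j \<le> m}) ` {..m + 1}
      \<union> (\<lambda>(i, i', j). {Neg (i, j), Neg (i', j)}) ` ({..m + 1} \<times> {..m + 1} \<times> {..m})"
    unfolding php_clauses_def by (fastforce simp: image_iff)
  then show ?thesis
    by (rule finite_subset) simp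
qed

text \<open>By finiteness, \<open>mset_set\<close> below does not take its default value \<open>{#}\<close>.\<close>

definition PHP :: "nat \<Rightarrow> (nat \<times> nat) formula" where
  "PHP m = image_mset (\<lambda>C. (C, \<infinity>)) (mset_set (php_clauses m))"

end

theory Submission imports Defs begin

text \<open>
  A weighted clause \<open>(C, w)\<close> contributes \<open>w\<close> times the indicator of \<open>C\<close> being falsified, and the
  proof mirrors the counting argument \<open>m + 1 \<le> \<Sum> x\<^sub>i\<^sub>j \<le> m\<close>. The virtual rule introduces
  \<open>(\<not>x\<^sub>i\<^sub>j, 1)\<close> and \<open>(\<not>x\<^sub>i\<^sub>j, -1)\<close> for all \<open>i, j\<close>. Resolving the clause of pigeon \<open>i\<close> with
  the units \<open>(\<not>x\<^sub>i\<^sub>j, 1)\<close> yields \<open>(\<box>, 1)\<close>, so the \<open>m + 1\<close> pigeons yield \<open>m + 1\<close> empty clauses.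
  Conversely, one empty clause and the clauses of hole \<open>j\<close> give back all \<open>(\<not>x\<^sub>i\<^sub>j, 1)\<close>: split
  \<open>(x\<^sub>1 \<or> \<dots> \<or> x\<^sub>k\<^sub>-\<^sub>1, 1)\<close> on \<open>x\<^sub>k\<close> and resolve \<open>x\<^sub>1 \<or> \<dots> \<or> x\<^sub>k\<^sub>-\<^sub>1 \<or> \<not>x\<^sub>k\<close> with the
  \<open>\<not>x\<^sub>i \<or> \<not>x\<^sub>k\<close>. The regained units cancel the negative weights, and one of the \<open>m + 1\<close> empty
  clauses is left.
\<close>

section \<open>Adding a side formula to a derivation\<close>

lemma regroup_frame: "regroup F G \<Longrightarrow> regroup (F + H) (G + H)"
proof (induction rule: regroup.induct)
  case (merge F C u v)
  show ?case using regroup.merge[of "F + H" C u v] by (simp add: ac_simps)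
next
  case (separate u v F C)
  then show ?case using regroup.separate[of u v "F + H" C] by (simp add: ac_simps)
next
  case (vanish F C)
  show ?case using regroup.vanish[of "F + H" C] by (simp add: ac_simps)
qed

text \<open>Every rule already carries an arbitrary remainder \<open>F\<close>, which absorbs
  \<open>H\<close>. Small derivations can therefore be run inside any larger formula.\<close>

lemma ressv_rule_frame: "ressv_rule F G \<Longrightarrow> ressv_rule (F + H) (G + H)"
proof (induction rule: ressv_rule.induct)
  case (resolution v w m A B x F)
  show ?case using ressv_rule.resolution[OF resolution, of "F + H"] by (simp only: ac_simps)
next
  case (split w F A x)
  then show ?case using ressv_rule.split[of w "F + H" A x] by (simp add: ac_simps)
next
  case (virtual A F r)
  then show ?case using ressv_rule.virtual[of A "F + H" r] by (simp add: ac_simps)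
qed

lemma regroup_rtranclp_frame: "regroup\<^sup>*\<^sup>* F G \<Longrightarrow> regroup\<^sup>*\<^sup>* (F + H) (G + H)"
  by (induction rule: rtranclp_induct) (auto dest: regroup_frame[where H = H])

text \<open>
  Derivability with \<open>n\<close> inferences. Clauses of nonnegative weight may be forgotten, because they
  are allowed to remain in the last formula of a proof.
\<close>

inductive reach :: "nat \<Rightarrow> 'a formula \<Rightarrow> 'a formula \<Rightarrow> bool" where
  reach_refl: "reach 0 F F"
| reach_regroup: "reach n F G \<Longrightarrow> regroup G H \<Longrightarrow> reach n F H"
| reach_rule: "reach n F G \<Longrightarrow> ressv_rule G H \<Longrightarrow> reach (Suc n) F H"
| reach_forget: "reach n F (G + {#(C, w)#}) \<Longrightarrow> 0 \<le> w \<Longrightarrow> reach n F G"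

lemma reach_frame: "reach n F G \<Longrightarrow> reach n (F + H) (G + H)"
proof (induction rule: reach.induct)
  case (reach_refl F)
  show ?case by (rule reach.reach_refl)
next
  case (reach_regroup n F G G')
  show ?case using reach_regroup.IH regroup_frame[OF reach_regroup.hyps(2)]
    by (rule reach.reach_regroup)
next
  case (reach_rule n F G G')
  show ?case using reach_rule.IH ressv_rule_frame[OF reach_rule.hyps(2)]
    by (rule reach.reach_rule)
next
  case (reach_forget n F G C w)
  have "reach n (F + H) ((G + H) + {#(C, w)#})"
    using reach_forget.IH by (simp only: ac_simps)
  then show ?case using reach_forget.hyps(2) by (rule reach.reach_forget)
qed

lemma reach_frame_left: "reach n F G \<Longrightarrow> reach n (H + F) (H + G)"
  using reach_frame[of n F G H] by (simp add: ac_simps)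

lemma reach_trans:
  assumes "reach k G H" "reach n F G"
  shows "reach (n + k) F H"
  using assms
proof (induction rule: reach.induct)
  case (reach_forget k G H C w)
  then show ?case using reach.reach_forget[of "n + k" F H C w] by blast
qed (simp_all add: reach_regroup reach_rule)

lemma reach_of_regroup: "regroup F G \<Longrightarrow> reach 0 F G"
  by (rule reach_regroup[OF reach_refl])

lemma reach_of_rule: "ressv_rule F G \<Longrightarrow> reach 1 F G"
  using reach_rule[OF reach_refl] by simp

lemma reach_forget_mset:
  assumes "reach n F (G + J)" "\<forall>(C, w) \<in># J. 0 \<le> w"
  shows "reach n F G"
  using assms
proof (induction J)
  case (add x J)
  obtain C w where x: "x = (C, w)" by (cases x)
  have "reach n F ((G + J) + {#(C, w)#})" using add.prems x by simp
  then have "reach n F (G + J)" using add.prems x by (auto intro: reach_forget)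
  then show ?case using add by auto
qed simp

text \<open>\<open>H\<close> acts as a catalyst: each derivation gives it back, so one copy serves
  all of them in turn. Below, \<open>H\<close> consists of the clauses of infinite weight.\<close>

lemma reach_sum:
  assumes "finite S" "\<And>i. i \<in> S \<Longrightarrow> reach k (H + F i) (H + G i)"
  shows "reach (card S * k) (H + (\<Sum>i\<in>S. F i)) (H + (\<Sum>i\<in>S. G i))"
  using assms
proof (induction S rule: finite_induct)
  case empty
  then show ?case by (simp add: reach_refl)
next
  case (insert i S)
  have "reach k (H + F i + sum F S) (H + G i + sum F S)"
    using insert.prems by (intro reach_frame) auto
  moreover have "reach (card S * k) (H + sum F S + G i) (H + sum G S + G i)"
    using insert by (intro reach_frame) auto
  ultimately have "reach (k + card S * k) (H + F i + sum F S) (H + sum G S + G i)"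
    by (intro reach_trans[of _ "H + sum F S + G i"]) (simp_all add: ac_simps)
  then show ?case using insert.hyps by (simp add: ac_simps)
qed

section \<open>From \<open>reach\<close> to proofs in the official sense\<close>

text \<open>Forgotten clauses are collected in \<open>J\<close> and carried along by the frame
  lemmas. A \<open>ressv_step\<close> contains exactly one inference, and later regroupings are
  absorbed into the last step; with \<open>n = 0\<close> there is no such step, hence the case
  distinction.\<close>

lemma reach_imp_proof_steps:
  assumes "reach n F G"
  shows "\<exists>J. (\<forall>(C, w) \<in># J. 0 \<le> w) \<and>
    (if n = 0 then regroup\<^sup>*\<^sup>* F (G + J) else (ressv_step ^^ n) F (G + J))"
  using assms
proof (induction rule: reach.induct)
  case (reach_refl F)
  show ?case by (rule exI[of _ "{#}"]) simp
next
  case (reach_regroup n F G H)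
  then obtain J where J: "\<forall>(C, w) \<in># J. 0 \<le> w"
    "if n = 0 then regroup\<^sup>*\<^sup>* F (G + J) else (ressv_step ^^ n) F (G + J)" by blast
  have r: "regroup (G + J) (H + J)" using reach_regroup.hyps by (intro regroup_frame)
  show ?case
  proof (cases n)
    case 0
    then show ?thesis using J r by (auto intro!: exI[of _ J])
  next
    case (Suc k)
    then obtain E where "(ressv_step ^^ k) F E" "ressv_step E (G + J)" using J by auto
    moreover have "ressv_step E (H + J)"
      using \<open>ressv_step E (G + J)\<close> r unfolding ressv_step_def
      by (meson rtranclp.rtrancl_into_rtrancl)
    ultimately show ?thesis using Suc J by (auto intro!: exI[of _ J] relcomppI)
  qed
next
  case (reach_rule n F G H)
  then obtain J where J: "\<forall>(C, w) \<in># J. 0 \<le> w"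
    "if n = 0 then regroup\<^sup>*\<^sup>* F (G + J) else (ressv_step ^^ n) F (G + J)" by blast
  have r: "ressv_rule (G + J) (H + J)" using reach_rule.hyps by (intro ressv_rule_frame)
  show ?case
  proof (cases n)
    case 0
    then have "ressv_step F (H + J)" using J r unfolding ressv_step_def by auto
    then show ?thesis using J 0 by (auto intro!: exI[of _ J])
  next
    case (Suc k)
    have "ressv_step (G + J) (H + J)" using r unfolding ressv_step_def by blast
    then have "(ressv_step ^^ Suc n) F (H + J)" using J Suc by (auto intro: relcomppI)
    then show ?thesis using J by (auto intro!: exI[of _ J])
  qed
next
  case (reach_forget n F G C w)
  then obtain J where J: "\<forall>(C, w) \<in># J. 0 \<le> w"
    "if n = 0 then regroup\<^sup>*\<^sup>* F (G + {#(C, w)#} + J)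
     else (ressv_step ^^ n) F (G + {#(C, w)#} + J)" by blast
  then show ?case using reach_forget.hyps
    by (intro exI[of _ "{#(C, w)#} + J"]) (auto simp: ac_simps split: if_splits)
qed

text \<open>A proof must end with strictly positive weights, but resolution may leave clauses of
  weight 0 among the forgotten ones.\<close>

lemma regroup_drop_zeros:
  assumes "\<forall>(C, w) \<in># J. (0::ereal) \<le> w"
  shows "\<exists>J'. (\<forall>(C, w) \<in># J'. 0 < w) \<and> regroup\<^sup>*\<^sup>* (G + J) (G + J')"
  using assms
proof (induction J)
  case empty
  show ?case by (rule exI[of _ "{#}"]) simp
next
  case (add x J)
  then obtain J' where J': "\<forall>(C, w) \<in># J'. 0 < w" "regroup\<^sup>*\<^sup>* (G + J) (G + J')" by auto
  obtain C w where x: "x = (C, w)" by (cases x)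
  have r: "regroup\<^sup>*\<^sup>* (G + add_mset x J) (G + J' + {#x#})"
    using regroup_rtranclp_frame[OF J'(2), of "{#x#}"] by simp
  show ?case
  proof (cases "w = 0")
    case True
    then have "regroup (G + J' + {#x#}) (G + J')" using x regroup.vanish by blast
    with r have "regroup\<^sup>*\<^sup>* (G + add_mset x J) (G + J')" by (rule rtranclp.rtrancl_into_rtrancl)
    then show ?thesis using J'(1) by blast
  next
    case False
    then show ?thesis using r J' x add.prems by (intro exI[of _ "add_mset x J'"]) auto
  qed
qed

lemma relpowp_imp_successively:
  "(R ^^ n) x y \<Longrightarrow>
    \<exists>xs. xs \<noteq> [] \<and> length xs = Suc n \<and> hd xs = x \<and> last xs = y \<and> successively R xs"
proof (induction n arbitrary: y)
  case 0
  then show ?case by (intro exI[of _ "[x]"]) auto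
next
  case (Suc n)
  then obtain z where z: "(R ^^ n) x z" "R z y" by auto
  then obtain xs where "xs \<noteq> []" "length xs = Suc n" "hd xs = x" "last xs = z"
    "successively R xs" using Suc.IH by blast
  then show ?case using z
    by (intro exI[of _ "xs @ [y]"]) (auto simp: successively_append_iff)
qed

lemma reach_imp_ressv_proof:
  assumes "reach n F G" "0 < n" "\<forall>(C, w) \<in># G. 0 < w"
  shows "\<exists>Fs. ressv_proof F G Fs \<and> proof_length Fs = n"
proof -
  obtain J where J: "\<forall>(C, w) \<in># J. 0 \<le> w" "(ressv_step ^^ n) F (G + J)"
    using reach_imp_proof_steps[OF assms(1)]
    unfolding if_not_P[OF less_imp_neq[OF assms(2), THEN not_sym]] by blast
  obtain J' where J': "\<forall>(C, w) \<in># J'. 0 < w" "regroup\<^sup>*\<^sup>* (G + J) (G + J')"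
    using regroup_drop_zeros[OF J(1)] by blast
  obtain k where k: "n = Suc k" using assms(2) gr0_implies_Suc by blast
  obtain E where E: "(ressv_step ^^ k) F E" "ressv_step E (G + J)"
    using J(2) unfolding k by (rule relpowp_Suc_E)
  obtain E' E'' where "regroup\<^sup>*\<^sup>* E E'" "ressv_rule E' E''" "regroup\<^sup>*\<^sup>* E'' (G + J)"
    using E(2) unfolding ressv_step_def by blast
  \<comment> \<open>Removing the zeros is appended to the regroupings that end the last step, so it
    costs no inference.\<close>
  moreover have "regroup\<^sup>*\<^sup>* E'' (G + J')" using calculation(3) J'(2) by (rule rtranclp_trans)
  ultimately have "ressv_step E (G + J')" unfolding ressv_step_def by blast
  with E(1) have "(ressv_step ^^ n) F (G + J')" unfolding k by (rule relpowp_Suc_I)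
  from relpowp_imp_successively[OF this]
  obtain Fs where "Fs \<noteq> []" "length Fs = Suc n" "hd Fs = F" "last Fs = G + J'"
    "successively ressv_step Fs" by blast
  moreover have "formula_sub G (G + J')" unfolding formula_sub_def by auto
  moreover have "\<forall>(C, w) \<in># G + J'. 0 < w" using assms(3) J'(1) by auto
  ultimately have "ressv_proof F G Fs" "proof_length Fs = n"
    unfolding ressv_proof_def proof_length_def by simp_all
  then show ?thesis by blast
qed

section \<open>Resolution with unit weights\<close>

lemma or_neg_weight: "(C, w) \<in># or_neg E ls u \<Longrightarrow> w = u"
  by (induction ls arbitrary: E) auto

text \<open>With both weights 1, the premises keep weight 0 and the compensation clauses get weight
  1, so all of them can be forgotten.\<close>

lemma reach_resolution:
  assumes "finite A" "finite B" "Pos x \<notin> A" "Neg x \<notin> B" "\<not> tautology (A \<union> B)"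
  shows "reach 1 {#(insert (Pos x) A, 1), (insert (Neg x) B, 1)#} {#(A \<union> B, 1)#}"
proof -
  obtain as bs where l: "set as = A" "distinct as" "set bs = B" "distinct bs"
    using assms finite_distinct_list by metis
  define J where "J = discard_tautologies (
         {#(insert (Pos x) A, 1 - 1 :: ereal), (insert (Neg x) B, 1 - 1)#}
         + or_neg (insert (Pos x) A) bs 1 + or_neg (insert (Neg x) B) as 1)"
  have "ressv_rule {#(insert (Pos x) A, 1), (insert (Neg x) B, 1)#} ({#(A \<union> B, 1)#} + J)"
    using ressv_rule.resolution[of 1 1 1 as bs x "{#}"] l assms
    by (simp add: J_def discard_tautologies_def)
  then have "reach 1 {#(insert (Pos x) A, 1), (insert (Neg x) B, 1)#} ({#(A \<union> B, 1)#} + J)"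
    by (rule reach_of_rule)
  moreover have "\<forall>(C, w) \<in># J. 0 \<le> w"
    unfolding J_def discard_tautologies_def
    by (auto dest: or_neg_weight simp: zero_ereal_def one_ereal_def)
  ultimately show ?thesis by (rule reach_forget_mset)
qed

text \<open>The variables of \<open>X\<close> are resolved away one by one; the side part
  \<open>D\<close> is common to all premises and does not grow.\<close>

lemma reach_resolve_all:
  assumes "finite X" "finite D" "\<not> tautology D" "\<And>x. x \<in> X \<Longrightarrow> Pos x \<notin> D \<and> Neg x \<notin> D"
  shows "reach (card X) ({#(Pos ` X \<union> D, 1)#} + (\<Sum>x\<in>X. {#(insert (Neg x) D, 1)#})) {#(D, 1)#}"
  using assms(1,4)
proof (induction X rule: finite_induct)
  case empty
  then show ?case by (simp add: reach_refl)
next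
  case (insert x X)
  let ?S = "\<Sum>x\<in>X. {#(insert (Neg x) D, 1::ereal)#}"
  have "\<not> tautology ((Pos ` X \<union> D) \<union> D)"
    using assms(3) insert.prems unfolding tautology_def by auto
  then have "reach 1 {#(insert (Pos x) (Pos ` X \<union> D), 1), (insert (Neg x) D, 1)#}
      {#((Pos ` X \<union> D) \<union> D, 1)#}"
    using assms(2) insert by (intro reach_resolution) auto
  from reach_frame[OF this, of ?S]
  have "reach 1 ({#(Pos ` insert x X \<union> D, 1), (insert (Neg x) D, 1)#} + ?S)
      ({#(Pos ` X \<union> D, 1)#} + ?S)"
    by (simp add: Un_assoc)
  moreover have "reach (card X) ({#(Pos ` X \<union> D, 1)#} + ?S) {#(D, 1)#}"
    using insert by auto
  ultimately have "reach (1 + card X)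
      ({#(Pos ` insert x X \<union> D, 1), (insert (Neg x) D, 1)#} + ?S) {#(D, 1)#}"
    using reach_trans by blast
  then show ?case using insert.hyps by (simp add: add_mset_commute)
qed

section \<open>Clauses of infinite weight and cardinality constraints\<close>

definition hard :: "'a clause set \<Rightarrow> 'a formula" where
  "hard K = image_mset (\<lambda>C. (C, \<infinity>)) (mset_set K)"

text \<open>Since \<infinity> + 1 = \<infinity>, separating off a copy of weight 1 leaves the hard
  clause intact and is mere bookkeeping.\<close>

lemma reach_hard_copy:
  assumes "finite K" "C \<in> K"
  shows "reach 0 (hard K) (hard K + {#(C, 1)#})"
proof -
  have K: "hard K = hard (K - {C}) + {#(C, \<infinity>)#}"
    using assms by (simp add: hard_def mset_set.remove)
  have "regroup (hard K) (hard (K - {C}) + {#(C, \<infinity>), (C, 1)#})"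
    using regroup.separate[of "\<infinity>" 1 "hard (K - {C})" C] unfolding K by simp
  from reach_of_regroup[OF this] show ?thesis by (simp add: K add_mset_commute)
qed

lemma reach_hard_copies:
  assumes "finite K" "finite S" "\<And>x. x \<in> S \<Longrightarrow> c x \<in> K"
  shows "reach 0 (hard K) (hard K + (\<Sum>x\<in>S. {#(c x, 1)#}))"
proof -
  have "reach (card S * 0) (hard K + (\<Sum>x\<in>S. {#})) (hard K + (\<Sum>x\<in>S. {#(c x, 1)#}))"
    using assms reach_hard_copy by (intro reach_sum) auto
  then show ?thesis by simp
qed

lemma reach_at_least_one:
  assumes "finite K" "finite X" "Pos ` X \<in> K"
  shows "reach (card X) (hard K + (\<Sum>x\<in>X. {#({Neg x}, 1)#})) (hard K + {#({}, 1)#})"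
proof -
  have "reach 0 (hard K + (\<Sum>x\<in>X. {#({Neg x}, 1)#}))
      (hard K + {#(Pos ` X, 1)#} + (\<Sum>x\<in>X. {#({Neg x}, 1)#}))"
    using assms by (intro reach_frame reach_hard_copy)
  moreover have "reach (card X) ({#(Pos ` X, 1)#} + (\<Sum>x\<in>X. {#({Neg x}, 1)#})) {#({}, 1)#}"
    using reach_resolve_all[of X "{}"] assms by (simp add: tautology_def)
  then have "reach (card X) (hard K + ({#(Pos ` X, 1)#} + (\<Sum>x\<in>X. {#({Neg x}, 1)#})))
      (hard K + {#({}, 1)#})" by (rule reach_frame_left)
  ultimately have "reach (0 + card X) (hard K + (\<Sum>x\<in>X. {#({Neg x}, 1)#})) (hard K + {#({}, 1)#})"
    by (intro reach_trans) (simp_all only: ac_simps)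
  then show ?thesis by simp
qed

text \<open>The positive clause over \<open>X\<close> is kept because the next variable is split on
  it. A new \<open>k\<close> costs one split and \<open>card X\<close> resolutions, that is, the new
  cardinality; this gives the sum.\<close>

lemma reach_at_most_one:
  assumes "finite K" "finite X"
    "\<And>x y. x \<in> X \<Longrightarrow> y \<in> X \<Longrightarrow> x \<noteq> y \<Longrightarrow> {Neg x, Neg y} \<in> K"
  shows "reach (\<Sum>{..card X}) (hard K + {#({}, 1)#})
    (hard K + {#(Pos ` X, 1)#} + (\<Sum>x\<in>X. {#({Neg x}, 1)#}))"
  using assms(2,3)
proof (induction X rule: finite_induct)
  case empty
  then show ?case by (simp add: reach_refl)
next
  case (insert k X)
  let ?U = "\<Sum>x\<in>X. {#({Neg x}, 1::ereal)#}"
  let ?P = "{#(Pos ` insert k X, 1::ereal)#}"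
  let ?Q = "{#(Pos ` X \<union> {Neg k}, 1::ereal)#}"
  let ?N = "\<Sum>x\<in>X. {#({Neg x, Neg k}, 1::ereal)#}"
  have "ressv_rule (hard K + ?U + {#(Pos ` X, 1)#}) (hard K + ?U + (?P + ?Q))"
    using ressv_rule.split[of 1 "hard K + ?U" "Pos ` X" k] by (simp add: add_mset_commute)
  then have "reach 1 (hard K + {#(Pos ` X, 1)#} + ?U) (hard K + (?U + (?P + ?Q)))"
    using reach_of_rule by (simp only: ac_simps)
  moreover have "reach 0 (hard K + (?U + (?P + ?Q))) (hard K + ?N + (?U + (?P + ?Q)))"
    using assms(1) insert by (intro reach_frame reach_hard_copies) auto
  \<comment> \<open>Resolving \<open>?Q\<close> with the copies \<open>?N\<close> removes all of
    \<open>X\<close> and leaves the unit clause of \<open>k\<close>.\<close>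
  moreover have "reach (card X) (?Q + ?N) {#({Neg k}, 1)#}"
    using insert.hyps by (intro reach_resolve_all) (auto simp: tautology_def)
  then have "reach (card X) ((hard K + ?U + ?P) + (?Q + ?N))
      ((hard K + ?U + ?P) + {#({Neg k}, 1)#})" by (rule reach_frame_left)
  then have "reach (card X) (hard K + ?N + (?U + (?P + ?Q)))
      (hard K + ?P + ({#({Neg k}, 1)#} + ?U))" by (simp only: ac_simps)
  ultimately have "reach (1 + 0 + card X) (hard K + {#(Pos ` X, 1)#} + ?U)
      (hard K + ?P + ({#({Neg k}, 1)#} + ?U))"
    using reach_trans by blast
  moreover have "reach (\<Sum>{..card X}) (hard K + {#({}, 1)#}) (hard K + {#(Pos ` X, 1)#} + ?U)"
    using insert by auto
  ultimately have "reach (\<Sum>{..card X} + (1 + 0 + card X)) (hard K + {#({}, 1)#})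
      (hard K + ?P + ({#({Neg k}, 1)#} + ?U))"
    using reach_trans by blast
  then show ?case using insert.hyps by simp
qed

lemma reach_virtual:
  assumes "finite A"
  shows "reach 1 F (F + ({#(A, 1)#} + {#(A, -1)#}))"
  using reach_of_rule[OF ressv_rule.virtual[OF assms, of F 1]]
  by (simp add: one_ereal_def add_mset_commute)

lemma reach_cancel: "reach 0 (F + ({#(A, 1)#} + {#(A, -1)#})) F"
proof -
  have "regroup (F + ({#(A, 1)#} + {#(A, -1)#})) (F + {#(A, 0)#})"
    using regroup.merge[of F A 1 "-1"] by (simp add: one_ereal_def zero_ereal_def add_mset_commute)
  then show ?thesis by (rule reach_forget[OF reach_of_regroup]) simp
qed

section \<open>Assembly over pigeons and holes\<close>

text \<open>The length counts \<open>m * (m + 1)\<close> virtual inferences, as many resolutions for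
  the pigeons, and \<open>\<Sum>{..m + 1}\<close> inferences for each hole.\<close>

lemma reach_PHP:
  "reach (2 * (m * (m + 1)) + m * \<Sum>{..m + 1}) (PHP m) {#({}, 1)#}"
proof -
  let ?K = "php_clauses m"
  let ?I = "{1..m + 1}" and ?J = "{1..m}"
  let ?V = "\<lambda>i j. {#({Neg (i, j)}, 1::ereal)#}"
  let ?W = "\<lambda>i j. {#({Neg (i, j)}, -1::ereal)#}"
  let ?E = "{#({}, 1::ereal)#} :: (nat \<times> nat) formula"
  let ?VV = "\<Sum>i\<in>?I. \<Sum>j\<in>?J. ?V i j" and ?WW = "\<Sum>i\<in>?I. \<Sum>j\<in>?J. ?W i j"
  let ?VW = "\<lambda>i j. ?V i j + ?W i j"
  have H: "PHP m = hard ?K" by (simp add: PHP_def hard_def)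
  have sVW: "(\<Sum>p\<in>?I \<times> ?J. case p of (i, j) \<Rightarrow> ?VW i j) = ?VV + ?WW"
    by (simp only: sum.cartesian_product[symmetric] sum.distrib)
  have "reach (card (?I \<times> ?J) * 1) (hard ?K + (\<Sum>p\<in>?I \<times> ?J. {#}))
      (hard ?K + (\<Sum>p\<in>?I \<times> ?J. case p of (i, j) \<Rightarrow> ?VW i j))"
    using reach_virtual[of "{Neg _}" "hard ?K"] by (intro reach_sum) auto
  then have virt: "reach (m * (m + 1)) (hard ?K) (hard ?K + (?VV + ?WW))"
    unfolding sVW by (simp add: ac_simps)
  have "reach (card (?I \<times> ?J) * 0) (hard ?K + (\<Sum>p\<in>?I \<times> ?J. case p of (i, j) \<Rightarrow> ?VW i j))
      (hard ?K + (\<Sum>p\<in>?I \<times> ?J. {#}))"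
    using reach_cancel[of "hard ?K"] by (intro reach_sum) auto
  then have cancel: "reach 0 (hard ?K + (?VV + ?WW)) (hard ?K)"
    unfolding sVW by simp
  have "reach m (hard ?K + (\<Sum>j\<in>?J. ?V i j)) (hard ?K + ?E)" if "i \<in> ?I" for i
  proof -
    have "Pos ` Pair i ` ?J = {Pos (i, j) | j. 1 \<le> j \<and> j \<le> m}" by auto
    then have "Pos ` Pair i ` ?J \<in> ?K"
      using that unfolding php_clauses_def by (intro UnI1) force
    then have "reach (card (Pair i ` ?J)) (hard ?K + (\<Sum>x\<in>Pair i ` ?J. {#({Neg x}, 1)#}))
        (hard ?K + ?E)"
      by (intro reach_at_least_one finite_php_clauses) auto
    then show ?thesis by (simp add: card_image inj_on_def sum.reindex)
  qed
  then have "reach (card ?I * m) (hard ?K + ?VV) (hard ?K + (\<Sum>i\<in>?I. ?E))"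
    by (intro reach_sum) auto
  \<comment> \<open>One empty clause is spent on each hole; the last one is the surplus.\<close>
  moreover have "(\<Sum>i\<in>?I. ?E) = (\<Sum>j\<in>?J. ?E) + ?E"
    by (simp add: atLeastAtMostSuc_conv)
  ultimately have pigeons: "reach (m * (m + 1)) (hard ?K + ?VV) (hard ?K + ((\<Sum>j\<in>?J. ?E) + ?E))"
    by (simp add: ac_simps)
  have "reach (\<Sum>{..m + 1}) (hard ?K + ?E) (hard ?K + (\<Sum>i\<in>?I. ?V i j))" if "j \<in> ?J" for j
  proof -
    let ?X = "(\<lambda>i. (i, j)) ` ?I"
    have pair: "{Neg (i, j), Neg (i', j)} \<in> ?K" if "i \<in> ?I" "i' \<in> ?I" "i < i'" for i i'
      using that \<open>j \<in> ?J\<close> unfolding php_clauses_def by auto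
    have "{Neg x, Neg y} \<in> ?K" if xy: "x \<in> ?X" "y \<in> ?X" "x \<noteq> y" for x y
    proof -
      obtain i i' where i: "x = (i, j)" "y = (i', j)" "i \<in> ?I" "i' \<in> ?I" using xy by blast
      then have "i < i' \<or> i' < i" using xy by auto
      then show ?thesis using pair[of i i'] pair[of i' i] i by (auto simp: insert_commute)
    qed
    then have "reach (\<Sum>{..card ?X}) (hard ?K + ?E)
        (hard ?K + {#(Pos ` ?X, 1)#} + (\<Sum>x\<in>?X. {#({Neg x}, 1)#}))"
      by (intro reach_at_most_one finite_php_clauses) auto
    then have "reach (\<Sum>{..card ?X}) (hard ?K + ?E)
        ((hard ?K + (\<Sum>x\<in>?X. {#({Neg x}, 1)#})) + {#(Pos ` ?X, 1)#})"
      by (simp only: ac_simps)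
    then have "reach (\<Sum>{..card ?X}) (hard ?K + ?E) (hard ?K + (\<Sum>x\<in>?X. {#({Neg x}, 1)#}))"
      by (rule reach_forget) simp
    moreover have "card ?X = m + 1" by (simp add: card_image inj_on_def)
    moreover have "(\<Sum>x\<in>?X. {#({Neg x}, 1::ereal)#}) = (\<Sum>i\<in>?I. ?V i j)"
      by (subst sum.reindex) (auto simp: inj_on_def)
    ultimately show ?thesis by simp
  qed
  then have "reach (card ?J * \<Sum>{..m + 1}) (hard ?K + (\<Sum>j\<in>?J. ?E))
      (hard ?K + (\<Sum>j\<in>?J. \<Sum>i\<in>?I. ?V i j))"
    by (intro reach_sum) auto
  moreover have "(\<Sum>j\<in>?J. \<Sum>i\<in>?I. ?V i j) = ?VV" by (rule sum.swap)
  ultimately have holes: "reach (m * \<Sum>{..m + 1}) (hard ?K + (\<Sum>j\<in>?J. ?E)) (hard ?K + ?VV)"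
    by simp
  \<comment> \<open>The negative units \<open>?WW\<close> stay aside while \<open>?VV\<close> is
    spent on the pigeons and regained from the holes; then both cancel.\<close>
  have 1: "reach (m * (m + 1)) (hard ?K + (?VV + ?WW)) (hard ?K + (\<Sum>j\<in>?J. ?E) + (?WW + ?E))"
    using reach_frame[OF pigeons, of ?WW] by (simp only: ac_simps)
  have 2: "reach (m * \<Sum>{..m + 1}) (hard ?K + (\<Sum>j\<in>?J. ?E) + (?WW + ?E))
      (hard ?K + (?VV + ?WW) + ?E)"
    using reach_frame[OF holes, of "?WW + ?E"] by (simp only: ac_simps)
  have 3: "reach 0 (hard ?K + (?VV + ?WW) + ?E) (?E + hard ?K)"
    using reach_frame[OF cancel, of ?E] by (simp only: ac_simps)
  have "reach (m * (m + 1) + m * (m + 1) + m * \<Sum>{..m + 1} + 0) (hard ?K) (?E + hard ?K)"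
    using reach_trans[OF 3 reach_trans[OF 2 reach_trans[OF 1 virt]]] .
  then have "reach (2 * (m * (m + 1)) + m * \<Sum>{..m + 1}) (hard ?K) (?E + hard ?K)"
    by (simp only: mult_2 add_0_right)
  moreover have "\<forall>(C, w) \<in># hard ?K. 0 \<le> w" by (auto simp: hard_def)
  ultimately show ?thesis unfolding H by (rule reach_forget_mset)
qed

theorem theorem12:
  "\<exists>p :: real poly. \<forall>m \<ge> (1::nat).
     \<exists>Fs. ressv_proof (PHP m) {#({}, 1)#} Fs \<and> real (proof_length Fs) \<le> poly p (real m)"
\<comment> \<open>The witness expands \<open>2m(m+1) + m(m+1)(m+2)\<close>, where
  \<open>\<Sum>{..m + 1}\<close> is bounded by its \<open>m + 2\<close> terms of size at most
  \<open>m + 1\<close>.\<close>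
proof (intro exI[of _ "[:0, 4, 5, 1:]"] allI impI)
  fix m :: nat
  assume "1 \<le> m"
  let ?n = "2 * (m * (m + 1)) + m * \<Sum>{..m + 1}"
  obtain Fs where Fs: "ressv_proof (PHP m) {#({}, 1)#} Fs" "proof_length Fs = ?n"
    using reach_imp_ressv_proof[OF reach_PHP, of m] \<open>1 \<le> m\<close> by auto
  have "\<Sum>{..m + 1} \<le> (m + 1) * (m + 2)"
    using sum_bounded_above[of "{..m + 1}" "\<lambda>i. i" "m + 1"] by simp
  then have "?n \<le> 2 * (m * (m + 1)) + m * ((m + 1) * (m + 2))"
    by (intro add_left_mono mult_left_mono) auto
  then have "real ?n \<le> real (2 * (m * (m + 1)) + m * ((m + 1) * (m + 2)))"
    by (rule of_nat_mono)
  also have "\<dots> = poly [:0, 4, 5, 1:] (real m)" by (simp add: algebra_simps)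
  finally show "\<exists>Fs. ressv_proof (PHP m) {#({}, 1)#} Fs \<and>
      real (proof_length Fs) \<le> poly [:0, 4, 5, 1:] (real m)"
    using Fs by metis
qed

end
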